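(* Let $0<\beta<1$, let $D$ be the $\beta$-stable subordinator, and let $E(t)=\inf\{x>0: D(x)>t\}$ be its first-exit time process. Then, for $t>0$, the distribution function of $E(t)$ is not infinitely divisible.
   Context: The $\beta$-stable subordinator $D=\{D(t)\}_{t\ge 0}$, $0<\beta<1$, is the L\'evy process with nondecreasing paths started at $0$ such that $\mathbb{E}\,e^{-sD(t)}=e^{-ts^{\beta}}$ for all $s\ge 0$, $t\ge 0$. *)

theory Defs
  imports "HOL-Probability.Probability"
begin

locale levy_process = prob_space M for M :: "'a measure" +
  fixes X :: "real \<Rightarrow> 'a \<Rightarrow> real"
  assumes random_variable_X: "t \<ge> 0 \<Longrightarrow> random_variable borel (X t)"
    and X_0: "\<omega> \<in> space M \<Longrightarrow> X 0 \<omega> = 0"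
    and independent_increments:
      "0 \<le> \<tau> 0 \<Longrightarrow> (\<And>k. k < n \<Longrightarrow> \<tau> k < \<tau> (Suc k)) \<Longrightarrow>
        indep_vars (\<lambda>_. borel) (\<lambda>k \<omega>. X (\<tau> (Suc k)) \<omega> - X (\<tau> k) \<omega>) {..<n}"
    and stationary_increments:
      "0 \<le> s \<Longrightarrow> 0 \<le> h \<Longrightarrow>
        distr M borel (\<lambda>\<omega>. X (s + h) \<omega> - X s \<omega>) = distr M borel (X h)"
    and right_continuous:
      "\<omega> \<in> space M \<Longrightarrow> t \<ge> 0 \<Longrightarrow> ((\<lambda>u. X u \<omega>) \<longlongrightarrow> X t \<omega>) (at_right t)"
    and left_limits:
      "\<omega> \<in> space M \<Longrightarrow> t > 0 \<Longrightarrow> \<exists>l. ((\<lambda>u. X u \<omega>) \<longlongrightarrow> l) (at_left t)"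

locale stable_subordinator = levy_process M D
  for M :: "'a measure" and D :: "real \<Rightarrow> 'a \<Rightarrow> real" +
  fixes \<beta> :: real
  assumes nondecreasing: "\<omega> \<in> space M \<Longrightarrow> mono_on {0..} (\<lambda>t. D t \<omega>)"
    and laplace_transform:
      "s \<ge> 0 \<Longrightarrow> t \<ge> 0 \<Longrightarrow> expectation (\<lambda>\<omega>. exp (- s * D t \<omega>)) = exp (- t * s powr \<beta>)"

text \<open>
  The infimum is taken in the reals. The set is empty only on the event that
  \<open>D\<close> never exceeds \<open>t\<close>, which has probability 0 for a stable subordinator,
  so the arbitrary value of \<open>Inf {}\<close> does not affect the law.
\<close>

definition first_exit_time :: "(real \<Rightarrow> 'a \<Rightarrow> real) \<Rightarrow> real \<Rightarrow> 'a \<Rightarrow> real" where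
  "first_exit_time D t \<omega> = Inf {x. x > 0 \<and> D x \<omega> > t}"

primrec convolution_power :: "real measure \<Rightarrow> nat \<Rightarrow> real measure" where
  "convolution_power \<nu> 0 = return borel 0"
| "convolution_power \<nu> (Suc n) = convolution \<nu> (convolution_power \<nu> n)"

definition infinitely_divisible :: "(real \<Rightarrow> real) \<Rightarrow> bool" where
  "infinitely_divisible F \<longleftrightarrow>
    (\<forall>n\<ge>1. \<exists>\<nu>. real_distribution \<nu> \<and> F = cdf (convolution_power \<nu> n))"

text \<open>
  Measurability makes the push-forward \<open>distr M borel (first_exit_time D t)\<close>
  meaningful: for a non-measurable function, \<open>distr\<close> is a junk measure.
\<close>

lemma (in stable_subordinator) first_exit_time_measurable:
  "random_variable borel (first_exit_time D t)"
proof -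
  define Q where "Q a = {q \<in> \<rat>. 0 < q \<and> q < (a::real)}" for a
  have "{\<omega> \<in> space M. first_exit_time D t \<omega> < a} \<in> sets M" for a
  proof -
    define A where "A = (\<Union>q\<in>Q a. {\<omega> \<in> space M. t < D q \<omega>})"
    define N where "N = {\<omega> \<in> space M. \<forall>k::nat. D (real k + 1) \<omega> \<le> t}"
    have [measurable]: "D q \<in> borel_measurable M" if "q \<ge> 0" for q
      using random_variable_X that by simp
    have "countable (Q a)"
      unfolding Q_def by (rule countable_subset[OF _ countable_rat]) auto
    then have A: "A \<in> sets M"
      unfolding A_def by (rule sets.countable_UN'') (auto simp: Q_def)
    have N: "N \<in> sets M"
      unfolding N_def by measurable
    have mono: "D x \<omega> \<le> D y \<omega>" if "\<omega> \<in> space M" "0 \<le> x" "x \<le> y" for x y \<omega>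
      using mono_onD[OF nondecreasing[OF that(1)]] that by auto
    have N_iff: "\<omega> \<in> N \<longleftrightarrow> {x. x > 0 \<and> D x \<omega> > t} = {}" if w: "\<omega> \<in> space M" for \<omega>
    proof
      assume *: "\<omega> \<in> N"
      have "D x \<omega> \<le> t" if "x > 0" for x
      proof -
        obtain k :: nat where "x \<le> real k" using real_arch_simple by blast
        then have "D x \<omega> \<le> D (real k + 1) \<omega>" using mono[OF w, of x "real k + 1"] that by simp
        also have "\<dots> \<le> t" using * by (simp add: N_def)
        finally show ?thesis .
      qed
      then show "{x. x > 0 \<and> D x \<omega> > t} = {}" by force
    next
      assume *: "{x. x > 0 \<and> D x \<omega> > t} = {}"
      have "D (real k + 1) \<omega> \<le> t" for k
      proof (rule ccontr)
        assume "\<not> ?thesis"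
        then have "real k + 1 \<in> {x. x > 0 \<and> D x \<omega> > t}" by simp
        with * show False by blast
      qed
      then show "\<omega> \<in> N" using w by (simp add: N_def)
    qed
    have A_iff: "first_exit_time D t \<omega> < a \<longleftrightarrow> \<omega> \<in> A" if w: "\<omega> \<in> space M" "\<omega> \<notin> N" for \<omega>
    proof -
      have "bdd_below {x. x > 0 \<and> D x \<omega> > t}" by (rule bdd_belowI[of _ 0]) auto
      moreover have "{x. x > 0 \<and> D x \<omega> > t} \<noteq> {}" using N_iff w by blast
      ultimately have "first_exit_time D t \<omega> < a \<longleftrightarrow> (\<exists>x>0. D x \<omega> > t \<and> x < a)"
        unfolding first_exit_time_def by (subst cInf_less_iff) auto
      also have "\<dots> \<longleftrightarrow> (\<exists>q\<in>Q a. D q \<omega> > t)"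
      proof
        assume "\<exists>x>0. D x \<omega> > t \<and> x < a"
        then obtain x where x: "x > 0" "D x \<omega> > t" "x < a" by blast
        obtain q where q: "q \<in> \<rat>" "x < q" "q < a" using Rats_dense_in_real[OF x(3)] by blast
        have "D x \<omega> \<le> D q \<omega>" using mono[OF w(1)] x q by simp
        then show "\<exists>q\<in>Q a. D q \<omega> > t" using x q by (intro bexI[of _ q]) (auto simp: Q_def)
      qed (auto simp: Q_def)
      finally show ?thesis using w by (auto simp: A_def)
    qed
    have N_eq: "first_exit_time D t \<omega> = Inf {}" if "\<omega> \<in> N" for \<omega>
    proof -
      have "\<omega> \<in> space M" using that by (simp add: N_def)
      then have "{x. x > 0 \<and> D x \<omega> > t} = {}" using N_iff that by blast
      then show ?thesis unfolding first_exit_time_def by (rule arg_cong)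
    qed
    have sub: "A \<subseteq> space M" "N \<subseteq> space M" by (auto simp: A_def N_def)
    have "{\<omega> \<in> space M. first_exit_time D t \<omega> < a}
      = (A - N) \<union> (if Inf {} < a then N else {})" (is "?L = ?R")
    proof (rule set_eqI)
      fix \<omega>
      show "\<omega> \<in> ?L \<longleftrightarrow> \<omega> \<in> ?R"
        using A_iff[of \<omega>] N_eq[of \<omega>] sub by (cases "\<omega> \<in> N") auto
    qed
    then show ?thesis using A N by auto
  qed
  then show ?thesis by (subst borel_measurable_iff_less) auto
qed

end

theory Submission imports Defs "HOL-Real_Asymp.Real_Asymp" begin

text \<open>
  Write \<open>E\<close> for the exit time from level \<open>t\<close>. Its law has a tail that is too light for an
  infinitely divisible law.

  Since \<open>D\<close> is nondecreasing, \<open>E \<ge> x\<close> forces \<open>D (x / 2) \<le> t\<close>. Chernoff's bound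
  \<open>P(D(x) \<le> t) \<le> exp (s t - x s\<^sup>\<beta>)\<close>, with \<open>s\<close> a small multiple of \<open>x\<^sup>p\<close> and
  \<open>p = 1 / (1 - \<beta>) > 1\<close>, gives \<open>P(E \<ge> x) \<le> exp (- C x\<^sup>p)\<close> (\<open>prob_le_tail\<close>).

  On the other hand, an infinitely divisible law on the half-line that is not a point mass
  cannot have a tail lighter than about \<open>exp (- C x ln x)\<close> (\<open>infinitely_divisible_tail\<close>).
  If it is the \<open>n\<close>-fold convolution power of \<open>\<nu>\<close>, then \<open>\<nu>\<close> must put mass at least \<open>\<delta> / n\<close>
  beyond some \<open>c > 0\<close>, where \<open>c\<close> and \<open>\<delta>\<close> do not depend on \<open>n\<close>
  (\<open>convolution_root_tail\<close>): otherwise the sum of the \<open>n\<close> small summands would have too little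
  randomness. If all \<open>n\<close> independent summands exceed \<open>c\<close>, their sum exceeds \<open>n c\<close>, an event of
  probability at least \<open>(\<delta> / n)\<^sup>n\<close>. As \<open>p > 1\<close>, the two bounds are incompatible for large \<open>n\<close>.

  It remains to see that \<open>E\<close> is not almost surely constant. If \<open>D(x) > t\<close> held almost surely,
  the Laplace transform would give \<open>exp (- x s\<^sup>\<beta>) \<le> exp (- s t)\<close> for all \<open>s\<close>, which fails for large
  \<open>s\<close> because \<open>\<beta> < 1\<close>; hence \<open>E\<close> takes arbitrarily large values with positive probability
  (\<open>prob_le_pos\<close>).
\<close>

section \<open>Convolution powers\<close>

lemma real_distribution_convolution_power:
  assumes "real_distribution \<nu>"
  shows "real_distribution (convolution_power \<nu> n)"
proof (induction n)
  case 0
  show ?case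
    by (simp add: real_distribution_def real_distribution_axioms_def prob_space_return)
next
  case (Suc n)
  interpret N: real_distribution \<nu> by fact
  interpret C: real_distribution "convolution_power \<nu> n" by fact
  interpret P: pair_prob_space \<nu> "convolution_power \<nu> n" ..
  have "prob_space (convolution \<nu> (convolution_power \<nu> n))"
    unfolding convolution_def by (rule P.prob_space_distr) measurable
  then show ?case
    by (simp add: real_distribution_def real_distribution_axioms_def)
qed

lemma emeasure_convolution_ge_mult:
  assumes "real_distribution \<mu>" and "real_distribution \<nu>"
    and [measurable]: "A \<in> sets borel" "B \<in> sets borel" "C \<in> sets borel"
    and sub: "\<And>x y. x \<in> A \<Longrightarrow> y \<in> B \<Longrightarrow> x + y \<in> C"
  shows "emeasure \<mu> A * emeasure \<nu> B \<le> emeasure (convolution \<mu> \<nu>) C"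
proof -
  interpret M: real_distribution \<mu> by fact
  interpret N: real_distribution \<nu> by fact
  have "emeasure \<mu> A * emeasure \<nu> B = (\<integral>\<^sup>+x. indicator A x * emeasure \<nu> B \<partial>\<mu>)"
    by (subst nn_integral_multc) auto
  also have "\<dots> = (\<integral>\<^sup>+x. \<integral>\<^sup>+y. indicator A x * indicator B y \<partial>\<nu> \<partial>\<mu>)"
    by (subst nn_integral_cmult) auto
  also have "\<dots> \<le> (\<integral>\<^sup>+x. \<integral>\<^sup>+y. indicator C (x + y) \<partial>\<nu> \<partial>\<mu>)"
    by (intro nn_integral_mono) (auto split: split_indicator dest: sub)
  also have "\<dots> = emeasure (convolution \<mu> \<nu>) C"
    by (rule convolution_emeasure'[symmetric])
      (auto intro: M.finite_measure_axioms N.finite_measure_axioms)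
  finally show ?thesis .
qed

text \<open>
  If every summand lies in \<open>A\<close>, the partial sums run through \<open>S 0, S 1, \<dots>\<close>; independence turns
  the probability of the former into a power. The sets may vary with the number of summands, so
  that the lemma serves for the tails \<open>{k c..}\<close> as well as for the negative half-line, which the
  empty sum misses.
\<close>

lemma measure_convolution_power_ge_power:
  assumes "real_distribution \<nu>"
    and "A \<in> sets borel" and "\<And>k. S k \<in> sets borel" and "0 \<in> S 0"
    and "\<And>k x y. x \<in> A \<Longrightarrow> y \<in> S k \<Longrightarrow> x + y \<in> S (Suc k)"
  shows "measure \<nu> A ^ n \<le> measure (convolution_power \<nu> n) (S n)"
proof (induction n)
  case 0
  show ?case using assms(3,4) by (simp add: measure_return)
next
  case (Suc n)
  interpret N: real_distribution \<nu> by fact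
  interpret C: real_distribution "convolution_power \<nu> n"
    by (rule real_distribution_convolution_power) fact
  interpret C': real_distribution "convolution_power \<nu> (Suc n)"
    by (rule real_distribution_convolution_power) fact
  have "measure \<nu> A * measure (convolution_power \<nu> n) (S n)
      \<le> measure (convolution_power \<nu> (Suc n)) (S (Suc n))"
    using emeasure_convolution_ge_mult[OF assms(1) C.real_distribution_axioms assms(2)
        assms(3)[of n] assms(3)[of "Suc n"] assms(5)]
    by (simp add: N.emeasure_eq_measure C.emeasure_eq_measure
        C'.emeasure_eq_measure[simplified] flip: ennreal_mult)
  moreover have "measure \<nu> A ^ Suc n \<le> measure \<nu> A * measure (convolution_power \<nu> n) (S n)"
    using Suc by (simp add: mult_left_mono)
  ultimately show ?case by linarith
qed

text \<open>
  Stated with the extended integral, since a law that also charges the negative numbers may have an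
  infinite Laplace transform.
\<close>

lemma nn_integral_exp_convolution_power:
  assumes "real_distribution \<nu>"
  shows "(\<integral>\<^sup>+x. ennreal (exp (- (s * x))) \<partial>convolution_power \<nu> n)
    = (\<integral>\<^sup>+x. ennreal (exp (- (s * x))) \<partial>\<nu>) ^ n"
proof (induction n)
  case 0
  show ?case by (simp add: nn_integral_return)
next
  case (Suc n)
  interpret N: real_distribution \<nu> by fact
  interpret C: real_distribution "convolution_power \<nu> n"
    by (rule real_distribution_convolution_power) fact
  have "(\<integral>\<^sup>+x. ennreal (exp (- (s * x))) \<partial>convolution_power \<nu> (Suc n))
      = (\<integral>\<^sup>+x. \<integral>\<^sup>+y. ennreal (exp (- (s * (x + y)))) \<partial>convolution_power \<nu> n \<partial>\<nu>)"
    unfolding convolution_power.simps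
    by (rule nn_integral_convolution)
      (auto intro: N.finite_measure_axioms C.finite_measure_axioms)
  also have "\<dots> = (\<integral>\<^sup>+x. \<integral>\<^sup>+y. ennreal (exp (- (s * x))) * ennreal (exp (- (s * y)))
      \<partial>convolution_power \<nu> n \<partial>\<nu>)"
    by (simp add: algebra_simps exp_add exp_diff exp_minus divide_inverse flip: ennreal_mult)
  also have "\<dots> = (\<integral>\<^sup>+x. ennreal (exp (- (s * x))) \<partial>\<nu>)
      * (\<integral>\<^sup>+y. ennreal (exp (- (s * y))) \<partial>convolution_power \<nu> n)"
    by (simp add: nn_integral_cmult nn_integral_multc)
  finally show ?case using Suc by simp
qed

section \<open>Tails of infinitely divisible laws on the half-line\<close>

text \<open>
  If all \<open>n\<close> summands are negative, so is their sum; the first event has the \<open>n\<close>-th power of the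
  probability that one summand is negative.
\<close>

lemma convolution_power_nonneg_imp_nonneg:
  assumes "real_distribution \<nu>" and "n \<ge> 1"
    and "measure (convolution_power \<nu> n) {..<0} = 0"
  shows "AE x in \<nu>. 0 \<le> x"
proof -
  interpret N: real_distribution \<nu> by fact
  \<comment> \<open>The empty sum is 0, hence the separate value of the set at 0.\<close>
  have "measure \<nu> {..<0} ^ n
      \<le> measure (convolution_power \<nu> n) ((\<lambda>k. if k = 0 then {0} else {..<0}) n)"
    by (rule measure_convolution_power_ge_power) (use assms(1) in \<open>auto split: if_splits\<close>)
  then have "measure \<nu> {..<0} ^ n \<le> 0"
    using assms by simp
  then have "measure \<nu> {..<0} = 0"
    by (metis measure_nonneg less_le zero_less_power not_le)
  then have "emeasure \<nu> {..<0} = 0"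
    by (simp add: N.emeasure_eq_measure)
  then show ?thesis
    by (intro AE_I[where N="{..<0}"]) auto
qed

lemma (in real_distribution) integrable_exp_of_nonneg:
  assumes "AE x in M. 0 \<le> x" and "s \<ge> 0"
  shows "integrable M (\<lambda>x. exp (- (s * x)))"
proof (rule integrable_const_bound[where B=1])
  show "AE x in M. norm (exp (- (s * x))) \<le> 1"
    using assms(1) by eventually_elim (use assms(2) in auto)
qed simp

lemma laplace_convolution_power:
  assumes "real_distribution \<nu>" and "AE x in \<nu>. 0 \<le> x"
    and "AE x in convolution_power \<nu> n. 0 \<le> x" and "s \<ge> 0"
  shows "(\<integral>x. exp (- (s * x)) \<partial>convolution_power \<nu> n) = (\<integral>x. exp (- (s * x)) \<partial>\<nu>) ^ n"
proof -
  interpret N: real_distribution \<nu> by fact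
  interpret C: real_distribution "convolution_power \<nu> n"
    by (rule real_distribution_convolution_power) fact
  show ?thesis
    using nn_integral_exp_convolution_power[OF assms(1), where s=s and n=n]
      N.integrable_exp_of_nonneg[OF assms(2,4)] C.integrable_exp_of_nonneg[OF assms(3,4)]
    by (simp add: nn_integral_eq_integral ennreal_power)
qed

text \<open>
  For \<open>k = E exp (-X)\<close> this is the variance of \<open>exp (-X)\<close>; for \<open>k = 1\<close> it expresses
  \<open>E (1 - exp (-X))\<^sup>2\<close> by the Laplace transform at 1 and 2. Both cases are needed below.
\<close>

lemma (in real_distribution) exp_square_deviation:
  fixes k :: real
  assumes "AE x in M. 0 \<le> x"
  shows integrable_exp_square_deviation: "integrable M (\<lambda>x. (exp (- x) - k)\<^sup>2)" (is ?int)
    and integral_exp_square_deviation: "(\<integral>x. (exp (- x) - k)\<^sup>2 \<partial>M)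
      = (\<integral>x. exp (- (2 * x)) \<partial>M) - 2 * k * (\<integral>x. exp (- x) \<partial>M) + k\<^sup>2" (is ?eq)
proof -
  have int: "integrable M (\<lambda>x. exp (- x))" "integrable M (\<lambda>x. exp (- (2 * x)))"
    using integrable_exp_of_nonneg[OF assms, of 1] integrable_exp_of_nonneg[OF assms, of 2]
    by simp_all
  have sq: "(exp (- x) - k)\<^sup>2 = exp (- (2 * x)) - 2 * k * exp (- x) + k\<^sup>2" for x :: real
    by (simp add: power2_diff exp_double[symmetric] algebra_simps)
  show ?int
    unfolding sq using int by (intro Bochner_Integration.integrable_add
        Bochner_Integration.integrable_diff integrable_mult_right) auto
  show ?eq
    unfolding sq using int prob_space by simp
qed

text \<open>
  The difference of the two sides is the variance of \<open>exp (-X)\<close>, which vanishes only if \<open>X\<close> is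
  almost surely constant.
\<close>

lemma (in real_distribution) laplace_strict_jensen:
  assumes nonneg: "AE x in M. 0 \<le> x" and nondeg: "\<And>k. \<not> (AE x in M. x = k)"
  shows "(\<integral>x. exp (- x) \<partial>M)\<^sup>2 < (\<integral>x. exp (- (2 * x)) \<partial>M)"
proof -
  define a where "a = (\<integral>x. exp (- x) \<partial>M)"
  define b where "b = (\<integral>x. exp (- (2 * x)) \<partial>M)"
  have "(\<integral>x. (exp (- x) - a)\<^sup>2 \<partial>M) = b - 2 * a * a + a\<^sup>2"
    using integral_exp_square_deviation[OF nonneg, of a] by (simp add: a_def b_def)
  also have "\<dots> = b - a\<^sup>2" by (simp add: power2_eq_square)
  finally have var: "(\<integral>x. (exp (- x) - a)\<^sup>2 \<partial>M) = b - a\<^sup>2" .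
  have "(\<integral>x. (exp (- x) - a)\<^sup>2 \<partial>M) \<noteq> 0"
  proof
    assume "(\<integral>x. (exp (- x) - a)\<^sup>2 \<partial>M) = 0"
    then have "AE x in M. (exp (- x) - a)\<^sup>2 = 0"
      using integral_nonneg_eq_0_iff_AE[OF integrable_exp_square_deviation[OF nonneg, of a]] by simp
    then have "AE x in M. x = - ln a"
      by eventually_elim (auto simp: minus_equation_iff)
    with nondeg show False by blast
  qed
  moreover have "(\<integral>x. (exp (- x) - a)\<^sup>2 \<partial>M) \<ge> 0" by simp
  ultimately have "a\<^sup>2 < b" unfolding var by simp
  then show ?thesis by (simp add: a_def b_def)
qed

lemma power_diff_le_mult_diff:
  fixes x y :: real
  assumes "0 \<le> x" "x \<le> y" "y \<le> 1"
  shows "y ^ n - x ^ n \<le> real n * (y - x)"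
proof (induction n)
  case (Suc n)
  have "y ^ Suc n - x ^ Suc n = y * (y ^ n - x ^ n) + x ^ n * (y - x)"
    by (simp add: algebra_simps)
  also have "\<dots> \<le> 1 * (y ^ n - x ^ n) + 1 * (y - x)"
    using assms by (intro add_mono mult_right_mono) (auto intro: power_mono power_le_one)
  finally show ?case using Suc by (simp add: algebra_simps)
qed simp

text \<open>
  The quantitative core: it bounds the mass beyond \<open>c\<close> of a convolution root \<open>\<nu>\<close> by constants of
  the given law. With \<open>f = 1 - exp (-X)\<close>, a bounded substitute for \<open>X\<close>, and \<open>X\<close> distributed as
  \<open>\<nu>\<close>, the Laplace transforms \<open>p = a\<^bsup>1/n\<^esup>\<close> and \<open>q = b\<^bsup>1/n\<^esup>\<close> of \<open>\<nu>\<close> at 1 and 2 yield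
  \<open>n E f\<^sup>2 \<ge> b - a\<^sup>2\<close> and \<open>n E f \<le> 1/a - 1\<close>. Since \<open>f \<le> 1 - exp (-c)\<close> where \<open>X < c\<close>, the values
  of \<open>X\<close> below \<open>c\<close> account for at most \<open>(1 - exp (-c)) (1/a - 1)\<close> of \<open>n E f\<^sup>2\<close>; the values above
  \<open>c\<close> must supply the rest, and there \<open>f \<le> 1\<close>.
\<close>

lemma (in real_distribution) convolution_root_tail:
  assumes nonneg: "AE x in M. 0 \<le> x"
    and \<nu>: "real_distribution \<nu>" and n: "n \<ge> 1" and M: "M = convolution_power \<nu> n"
    and a: "a = (\<integral>x. exp (- x) \<partial>M)" and b: "b = (\<integral>x. exp (- (2 * x)) \<partial>M)"
    and c: "c \<ge> 0"
  shows "real n * measure \<nu> {c..} \<ge> (b - a\<^sup>2) - (1 - exp (- c)) * (1 / a - 1)"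
proof -
  interpret N: real_distribution \<nu> by fact
  have "measure M {..<0} = 0"
  proof -
    have "emeasure M {..<0} = 0"
      by (rule AE_iff_measurable[THEN iffD1, OF _ _ nonneg]) auto
    then show ?thesis by (simp add: emeasure_eq_measure)
  qed
  then have nn: "AE x in \<nu>. 0 \<le> x"
    using convolution_power_nonneg_imp_nonneg[OF \<nu> n] M by simp
  define p where "p = (\<integral>x. exp (- x) \<partial>\<nu>)"
  define q where "q = (\<integral>x. exp (- (2 * x)) \<partial>\<nu>)"
  have int [simp]: "integrable \<nu> (\<lambda>x. exp (- x))" "integrable \<nu> (\<lambda>x. exp (- (2 * x)))"
    using N.integrable_exp_of_nonneg[OF nn, of 1] N.integrable_exp_of_nonneg[OF nn, of 2]
    by simp_all
  have ap: "a = p ^ n" and bq: "b = q ^ n"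
    using laplace_convolution_power[OF \<nu> nn nonneg[unfolded M], of 1]
      laplace_convolution_power[OF \<nu> nn nonneg[unfolded M], of 2] M by (simp_all add: a b p_def q_def)
  have p0: "p > 0"
  proof -
    have "p \<ge> 0" unfolding p_def by simp
    moreover have "p \<noteq> 0"
    proof
      assume "p = 0"
      then have "AE x in \<nu>. exp (- x) = 0"
        unfolding p_def using integral_nonneg_eq_0_iff_AE[OF int(1)] by simp
      then show False by simp
    qed
    ultimately show ?thesis by simp
  qed
  have q1: "q \<le> 1"
  proof -
    have "q \<le> (\<integral>x. 1 \<partial>\<nu>)" unfolding q_def
      by (rule integral_mono_AE) (use nn in \<open>auto elim!: eventually_mono\<close>)
    then show ?thesis using N.prob_space by simp
  qed
  note int_sq = N.integrable_exp_square_deviation[OF nn]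
  have sq: "(\<integral>x. (exp (- x) - k)\<^sup>2 \<partial>\<nu>) = q - 2 * k * p + k\<^sup>2" for k
    using N.integral_exp_square_deviation[OF nn, of k] by (simp add: p_def q_def)
  have pq: "p\<^sup>2 \<le> q"
  proof -
    have "0 \<le> (\<integral>x. (exp (- x) - p)\<^sup>2 \<partial>\<nu>)" by simp
    then show ?thesis unfolding sq by (simp add: power2_eq_square)
  qed
  have second: "b - a\<^sup>2 \<le> real n * (q - 2 * p + 1)"
  proof -
    have "b - a\<^sup>2 = q ^ n - (p\<^sup>2) ^ n"
      by (simp add: ap bq mult.commute flip: power_mult)
    also have "\<dots> \<le> real n * (q - p\<^sup>2)"
      by (rule power_diff_le_mult_diff) (use pq q1 in auto)
    also have "\<dots> \<le> real n * (q - 2 * p + 1)"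
      using zero_le_power2[of "p - 1"]
      by (intro mult_left_mono) (auto simp: power2_diff)
    finally show ?thesis .
  qed
  have first: "real n * (1 - p) \<le> 1 / a - 1"
  proof -
    have "1 - p \<le> 1 / p - 1"
    proof -
      have "0 \<le> (1 - p)\<^sup>2 / p" using p0 by simp
      also have "\<dots> = 1 / p - 2 + p" using p0 by (simp add: field_simps power2_eq_square)
      finally show ?thesis by simp
    qed
    then have "real n * (1 - p) \<le> real n * (1 / p - 1)" by (rule mult_left_mono) simp
    also have "\<dots> \<le> (1 + (1 / p - 1)) ^ n - 1"
      using Bernoulli_inequality[of "1 / p - 1" n] p0 by simp
    also have "\<dots> = 1 / a - 1" by (simp add: ap power_one_over)
    finally show ?thesis .
  qed
  define \<eta> where "\<eta> = 1 - exp (- c)"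
  have \<eta>0: "\<eta> \<ge> 0" using c by (simp add: \<eta>_def)
  have "q - 2 * p + 1 = (\<integral>x. (exp (- x) - 1)\<^sup>2 \<partial>\<nu>)" unfolding sq by simp
  also have "\<dots> \<le> (\<integral>x. \<eta> * (1 - exp (- x)) + indicator {c..} x \<partial>\<nu>)"
  proof (rule integral_mono_AE)
    show "AE x in \<nu>. (exp (- x) - 1)\<^sup>2 \<le> \<eta> * (1 - exp (- x)) + indicator {c..} x"
      using nn
    proof eventually_elim
      case (elim x)
      define f where "f = 1 - exp (- x)"
      have f: "0 \<le> f" "f \<le> 1" using elim by (auto simp: f_def)
      have "f\<^sup>2 \<le> \<eta> * f + indicator {c..} x"
      proof (cases "c \<le> x")
        case True
        then show ?thesis using f \<eta>0 by (simp add: power_le_one add_increasing)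
      next
        case False
        then have "f \<le> \<eta>" by (simp add: f_def \<eta>_def)
        then show ?thesis using f False by (simp add: power2_eq_square mult_right_mono)
      qed
      then show ?case by (simp add: f_def power2_commute)
    qed
  qed (use int int_sq in \<open>auto simp: N.emeasure_eq_measure\<close>)
  also have "\<dots> = \<eta> * (1 - p) + measure \<nu> {c..}"
    using int N.prob_space by (simp add: p_def N.emeasure_eq_measure)
  finally have "q - 2 * p + 1 \<le> \<eta> * (1 - p) + measure \<nu> {c..}" .
  then have "real n * (q - 2 * p + 1) \<le> real n * (\<eta> * (1 - p) + measure \<nu> {c..})"
    by (rule mult_left_mono) simp
  also have "\<dots> = \<eta> * (real n * (1 - p)) + real n * measure \<nu> {c..}"
    by (simp add: algebra_simps)
  also have "\<dots> \<le> \<eta> * (1 / a - 1) + real n * measure \<nu> {c..}"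
    using mult_left_mono[OF first \<eta>0] by simp
  finally show ?thesis using second by (simp add: \<eta>_def)
qed

text \<open>
  In the bound for the convolution roots, \<open>v = b - a\<^sup>2\<close> is positive and the error term vanishes as
  \<open>c\<close> tends to 0. So \<open>c\<close> can be fixed, independently of \<open>n\<close>, such that the roots have mass at
  least \<open>v / (2 n)\<close> beyond \<open>c\<close>.
\<close>

lemma (in real_distribution) infinitely_divisible_tail:
  assumes nonneg: "AE x in M. 0 \<le> x" and nondeg: "\<And>k. \<not> (AE x in M. x = k)"
    and ID: "infinitely_divisible (cdf M)"
  obtains c \<delta> where "c > 0" and "\<delta> > 0"
    and "\<And>n. n \<ge> 1 \<Longrightarrow> (\<delta> / real n) ^ n \<le> measure M {real n * c..}"
proof -
  define a where "a = (\<integral>x. exp (- x) \<partial>M)"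
  define b where "b = (\<integral>x. exp (- (2 * x)) \<partial>M)"
  define v where "v = b - a\<^sup>2"
  have v: "v > 0" using laplace_strict_jensen[OF nonneg nondeg] by (simp add: v_def a_def b_def)
  have "((\<lambda>c. (1 - exp (- c)) * (1 / a - 1)) \<longlongrightarrow> (1 - exp (- 0)) * (1 / a - 1)) (at_right 0)"
    by (intro tendsto_intros)
  then have "\<forall>\<^sub>F c in at_right 0. (1 - exp (- c)) * (1 / a - 1) < v / 2"
    using v by (intro order_tendstoD(2)) auto
  moreover have "\<forall>\<^sub>F c in at_right (0::real). c > 0" by (rule eventually_at_right_less)
  ultimately have "\<forall>\<^sub>F c in at_right 0. (1 - exp (- c)) * (1 / a - 1) < v / 2 \<and> c > 0"
    by (rule eventually_conj)
  then obtain c where c: "(1 - exp (- c)) * (1 / a - 1) < v / 2" "c > 0"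
    using eventually_happens' trivial_limit_at_right_real by blast
  show ?thesis
  proof (rule that)
    fix n :: nat assume n: "n \<ge> 1"
    then obtain \<nu> where \<nu>: "real_distribution \<nu>" and eq: "cdf M = cdf (convolution_power \<nu> n)"
      using ID unfolding infinitely_divisible_def by blast
    have M: "M = convolution_power \<nu> n"
      by (rule cdf_unique[OF real_distribution_axioms real_distribution_convolution_power[OF \<nu>] eq])
    have "real n * measure \<nu> {c..} \<ge> v - (1 - exp (- c)) * (1 / a - 1)"
      unfolding v_def by (rule convolution_root_tail[OF nonneg \<nu> n M a_def b_def]) (use c in simp)
    then have "v / 2 \<le> real n * measure \<nu> {c..}" using c(1) by linarith
    then have "v / 2 / real n \<le> measure \<nu> {c..}"
      using n by (simp add: divide_le_eq mult_ac)
    then have "(v / 2 / real n) ^ n \<le> measure \<nu> {c..} ^ n"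
      using v by (intro power_mono) auto
    also have "\<dots> \<le> measure (convolution_power \<nu> n) {real n * c..}"
      by (rule measure_convolution_power_ge_power[where S="\<lambda>n. {real n * c..}"])
        (use \<nu> in \<open>auto simp: algebra_simps\<close>)
    finally show "(v / 2 / real n) ^ n \<le> measure M {real n * c..}" using M by simp
  qed (use c v in auto)
qed

text \<open>
  Taking logarithms at the points \<open>n c\<close> and dividing by \<open>n\<close>, the two bounds on the tail require
  \<open>C c\<^sup>p n\<^bsup>p - 1\<^esup> \<le> ln n - ln \<delta>\<close> for all \<open>n\<close>.
\<close>

lemma (in real_distribution) light_tail_not_infinitely_divisible:
  fixes C p :: real
  assumes nonneg: "AE x in M. 0 \<le> x" and nondeg: "\<And>k. \<not> (AE x in M. x = k)"
    and "C > 0" and "p > 1"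
    and tail: "\<And>x. x > 0 \<Longrightarrow> measure M {x..} \<le> exp (- C * x powr p)"
  shows "\<not> infinitely_divisible (cdf M)"
proof
  assume "infinitely_divisible (cdf M)"
  then obtain c \<delta> where c: "c > 0" and \<delta>: "\<delta> > 0"
    and lower: "\<And>n. n \<ge> 1 \<Longrightarrow> (\<delta> / real n) ^ n \<le> measure M {real n * c..}"
    using infinitely_divisible_tail[OF nonneg nondeg] by blast
  define C' where "C' = C * c powr p"
  have C': "C' > 0" using c \<open>C > 0\<close> by (simp add: C'_def)
  have "filterlim (\<lambda>x::real. C' * x powr (p - 1) - ln x + ln \<delta>) at_top at_top"
    using C' \<open>p > 1\<close> by real_asymp
  then have "filterlim (\<lambda>n::nat. C' * real n powr (p - 1) - ln (real n) + ln \<delta>) at_top sequentially"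
    by (rule filterlim_compose[OF _ filterlim_real_sequentially])
  then have "\<forall>\<^sub>F n::nat in sequentially. C' * real n powr (p - 1) - ln (real n) + ln \<delta> > 0"
    by (simp add: filterlim_at_top_dense)
  moreover have "\<forall>\<^sub>F n::nat in sequentially. n \<ge> 1" by (rule eventually_ge_at_top)
  ultimately have "\<forall>\<^sub>F n::nat in sequentially.
      C' * real n powr (p - 1) - ln (real n) + ln \<delta> > 0 \<and> n \<ge> 1"
    by (rule eventually_conj)
  then obtain n :: nat where n: "C' * real n powr (p - 1) - ln (real n) + ln \<delta> > 0" "n \<ge> 1"
    using eventually_happens' sequentially_bot by blast
  have "exp (real n * (ln \<delta> - ln (real n))) = (\<delta> / real n) ^ n"
    using n \<delta> by (simp add: exp_of_nat_mult exp_diff)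
  also have "\<dots> \<le> measure M {real n * c..}" by (rule lower) fact
  also have "\<dots> \<le> exp (- C * (real n * c) powr p)" by (rule tail) (use n c in auto)
  finally have "real n * (ln \<delta> - ln (real n)) \<le> - C * (real n * c) powr p" by simp
  also have "(real n * c) powr p = real n * (c powr p * real n powr (p - 1))"
    using n c by (simp add: powr_mult powr_diff)
  finally have "real n * (C' * real n powr (p - 1) - ln (real n) + ln \<delta>) \<le> 0"
    by (simp add: C'_def algebra_simps)
  moreover have "real n * (C' * real n powr (p - 1) - ln (real n) + ln \<delta>) > 0"
    using n by simp
  ultimately show False by simp
qed

section \<open>The exit time of a stable subordinator\<close>

context stable_subordinator
begin

lemma mono_D: "\<omega> \<in> space M \<Longrightarrow> 0 \<le> x \<Longrightarrow> x \<le> y \<Longrightarrow> D x \<omega> \<le> D y \<omega>"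
  using mono_onD[OF nondecreasing, of \<omega> x y] by simp

text \<open>
  A function that is not integrable has the integral 0, whereas the Laplace transform is positive.
\<close>

lemma integrable_laplace:
  assumes "s \<ge> 0" "x \<ge> 0"
  shows "integrable M (\<lambda>\<omega>. exp (- s * D x \<omega>))"
  using laplace_transform[OF assms] not_integrable_integral_eq[of M "\<lambda>\<omega>. exp (- s * D x \<omega>)"]
  by fastforce

lemma prob_le_chernoff:
  assumes "s \<ge> 0" "x \<ge> 0"
  shows "prob {\<omega> \<in> space M. D x \<omega> \<le> t} \<le> exp (s * t - x * s powr \<beta>)"
proof -
  have [measurable]: "D x \<in> borel_measurable M" using random_variable_X assms by simp
  let ?A = "{\<omega> \<in> space M. D x \<omega> \<le> t}"
  have "prob ?A = (\<integral>\<omega>. indicator ?A \<omega> \<partial>M)" by simp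
  also have "\<dots> \<le> (\<integral>\<omega>. exp (s * t) * exp (- s * D x \<omega>) \<partial>M)"
  proof (rule integral_mono)
    show "indicator ?A \<omega> \<le> exp (s * t) * exp (- s * D x \<omega>)" for \<omega>
      using assms by (auto simp: indicator_def mult_left_mono simp flip: exp_add)
  qed (use integrable_laplace[OF assms] in \<open>auto simp: emeasure_eq_measure\<close>)
  also have "\<dots> = exp (s * t - x * s powr \<beta>)"
    using laplace_transform[OF assms] by (simp add: exp_diff exp_minus divide_inverse)
  finally show ?thesis .
qed

text \<open>
  In Chernoff's bound take \<open>s = r y\<close> with \<open>y = x\<^bsup>1 / (1 - \<beta>)\<^esup>\<close>. Then \<open>x y\<^sup>\<beta> = y\<close>, so the exponent
  is \<open>(r t - r\<^sup>\<beta>) y\<close>. It is negative for small \<open>r\<close>, since \<open>\<beta> < 1\<close>.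
\<close>

lemma prob_le_tail:
  assumes "\<beta> < 1" "t > 0"
  obtains C where "C > 0"
    and "\<And>x. x > 0 \<Longrightarrow> prob {\<omega> \<in> space M. D x \<omega> \<le> t} \<le> exp (- C * x powr (1 / (1 - \<beta>)))"
proof -
  \<comment> \<open>This \<open>r\<close> makes \<open>r t\<close> exactly half of \<open>r\<^sup>\<beta>\<close>.\<close>
  define r where "r = (1 / (2 * t)) powr (1 / (1 - \<beta>))"
  have r: "r > 0" using assms by (simp add: r_def)
  have "r powr (1 - \<beta>) = 1 / (2 * t)" using assms by (simp add: r_def powr_powr)
  then have rt: "r * t = r powr \<beta> / 2"
    using r assms by (simp add: powr_diff field_simps)
  show ?thesis
  proof (rule that)
    show "r powr \<beta> / 2 > 0" using r by simp
    fix x :: real assume x: "x > 0"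
    define y where "y = x powr (1 / (1 - \<beta>))"
    have y: "y > 0" using x by (simp add: y_def)
    have "x * y powr \<beta> = x powr (1 + \<beta> / (1 - \<beta>))"
      using x by (simp add: y_def powr_powr powr_add)
    also have "1 + \<beta> / (1 - \<beta>) = 1 / (1 - \<beta>)" using assms by (simp add: field_simps)
    finally have xy: "x * y powr \<beta> = y" by (simp add: y_def)
    have "r * y * t - x * (r * y) powr \<beta> = (r * t) * y - r powr \<beta> * (x * y powr \<beta>)"
      using r y by (simp add: powr_mult)
    also have "\<dots> = - (r powr \<beta> / 2) * y" unfolding xy rt by (simp add: algebra_simps)
    finally show "prob {\<omega> \<in> space M. D x \<omega> \<le> t} \<le> exp (- (r powr \<beta> / 2) * y)"
      using prob_le_chernoff[of "r * y" x t] r x y by simp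
  qed
qed

text \<open>
  Otherwise \<open>D(x) > t\<close> almost surely, so that \<open>exp (- x s\<^sup>\<beta>) \<le> exp (- s t)\<close> for all \<open>s \<ge> 0\<close>,
  although \<open>s t\<close> outgrows \<open>x s\<^sup>\<beta>\<close>.
\<close>

lemma prob_le_pos:
  assumes "\<beta> < 1" "t > 0" "x \<ge> 0"
  shows "prob {\<omega> \<in> space M. D x \<omega> \<le> t} > 0"
proof (rule ccontr)
  have [measurable]: "D x \<in> borel_measurable M" using random_variable_X assms by simp
  assume "\<not> ?thesis"
  then have "prob {\<omega> \<in> space M. D x \<omega> \<le> t} = 0"
    using measure_nonneg[of M "{\<omega> \<in> space M. D x \<omega> \<le> t}"] by linarith
  then have "AE \<omega> in M. \<not> D x \<omega> \<le> t"
    by (subst AE_iff_measurable[where N="{\<omega> \<in> space M. D x \<omega> \<le> t}"])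
      (auto simp: emeasure_eq_measure)
  then have large: "AE \<omega> in M. t \<le> D x \<omega>" by eventually_elim simp
  have le: "s * t \<le> x * s powr \<beta>" if "s \<ge> 0" for s
  proof -
    have "expectation (\<lambda>\<omega>. exp (- s * D x \<omega>)) \<le> expectation (\<lambda>_. exp (- s * t))"
    proof (rule integral_mono_AE)
      show "AE \<omega> in M. exp (- s * D x \<omega>) \<le> exp (- s * t)"
        using large by eventually_elim (use that in \<open>auto intro: mult_left_mono\<close>)
    qed (use integrable_laplace[OF that assms(3)] in auto)
    then show ?thesis using laplace_transform[OF that assms(3)] by (simp add: prob_space)
  qed
  have "filterlim (\<lambda>s::real. s * t - x * s powr \<beta>) at_top at_top"
  proof (cases "x = 0")
    case False
    then show ?thesis using assms by real_asymp
  qed (use assms in real_asymp)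
  then have "\<forall>\<^sub>F s in at_top. s * t - x * s powr \<beta> > 0"
    unfolding filterlim_at_top_dense by blast
  moreover have "\<forall>\<^sub>F s::real in at_top. s \<ge> 0" by (rule eventually_ge_at_top)
  ultimately have "\<forall>\<^sub>F s in at_top. s * t - x * s powr \<beta> > 0 \<and> s \<ge> 0"
    by (rule eventually_conj)
  then obtain s where "s * t - x * s powr \<beta> > 0" "s \<ge> 0"
    using eventually_happens' trivial_limit_at_top_linorder by blast
  then show False using le[of s] by simp
qed

text \<open>
  Paths that never exceed \<open>t\<close> have \<open>D(k + 1) \<le> t\<close> for every natural \<open>k\<close>, and these probabilities
  tend to 0. This excludes the paths whose exit time is the infimum of the empty set.
\<close>

lemma AE_exits:
  assumes "\<beta> < 1" "t > 0"
  shows "AE \<omega> in M. \<exists>x>0. D x \<omega> > t"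
proof -
  obtain C where C: "C > 0"
    and tail: "\<And>x. x > 0 \<Longrightarrow> prob {\<omega> \<in> space M. D x \<omega> \<le> t} \<le> exp (- C * x powr (1 / (1 - \<beta>)))"
    using prob_le_tail[OF assms] by blast
  define N where "N = {\<omega> \<in> space M. \<forall>k::nat. D (real k + 1) \<omega> \<le> t}"
  have [measurable]: "D x \<in> borel_measurable M" if "x \<ge> 0" for x
    using random_variable_X that by simp
  have N [measurable]: "N \<in> sets M" unfolding N_def by measurable
  have "prob N \<le> exp (- C * (real k + 1) powr (1 / (1 - \<beta>)))" for k
    by (rule order.trans[OF finite_measure_mono tail]) (auto simp: N_def)
  moreover have "(\<lambda>k::nat. exp (- C * (real k + 1) powr (1 / (1 - \<beta>)))) \<longlonglongrightarrow> 0"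
  proof -
    define p where "p = 1 / (1 - \<beta>)"
    have "p > 0" using assms by (simp add: p_def)
    then show ?thesis unfolding p_def[symmetric] using C by real_asymp
  qed
  ultimately have "prob N \<le> 0"
    by (intro LIMSEQ_le_const[where X="\<lambda>k. exp (- C * (real k + 1) powr (1 / (1 - \<beta>)))"]) auto
  then have "emeasure M N = 0" by (simp add: emeasure_eq_measure measure_le_0_iff)
  moreover have "{\<omega> \<in> space M. \<not> (\<exists>x>0. D x \<omega> > t)} \<subseteq> N"
  proof
    fix \<omega> assume "\<omega> \<in> {\<omega> \<in> space M. \<not> (\<exists>x>0. D x \<omega> > t)}"
    then have "\<omega> \<in> space M" and "\<not> D (real k + 1) \<omega> > t" for k :: nat
      by (auto dest: spec[of _ "real k + 1"])
    then show "\<omega> \<in> N" by (auto simp: N_def not_less)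
  qed
  ultimately show ?thesis by (intro AE_I[where N=N]) auto
qed

lemma le_before_first_exit_time:
  assumes "0 < y" "y < first_exit_time D t \<omega>"
  shows "D y \<omega> \<le> t"
proof (rule ccontr)
  assume "\<not> ?thesis"
  then have "Inf {x. x > 0 \<and> D x \<omega> > t} \<le> y"
    using assms by (intro cInf_lower bdd_belowI[of _ 0]) auto
  then show False using assms by (simp add: first_exit_time_def)
qed

lemma first_exit_time_ge:
  assumes "\<omega> \<in> space M" "\<exists>x>0. D x \<omega> > t" "y \<ge> 0" "D y \<omega> \<le> t"
  shows "y \<le> first_exit_time D t \<omega>"
  unfolding first_exit_time_def
proof (rule cInf_greatest)
  fix x assume "x \<in> {x. x > 0 \<and> D x \<omega> > t}"
  then show "y \<le> x" using mono_D[OF assms(1), of x y] assms(4) by force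
qed (use assms in blast)

end

theorem proposition2p5:
  fixes M :: "'a measure" and D :: "real \<Rightarrow> 'a \<Rightarrow> real" and \<beta> t :: real
  assumes "0 < \<beta>" and "\<beta> < 1"
    and "stable_subordinator M D \<beta>"
    and "t > 0"
  shows "\<not> infinitely_divisible (cdf (distr M borel (first_exit_time D t)))"
proof -
  interpret stable_subordinator M D \<beta> by fact
  let ?E = "first_exit_time D t"
  note E [measurable] = first_exit_time_measurable[of t]
  have D_meas [measurable]: "D x \<in> borel_measurable M" if "x \<ge> 0" for x
    using random_variable_X that by simp
  interpret L: real_distribution "distr M borel ?E"
    by (simp add: real_distribution_distr)
  note exits = AE_exits[OF assms(2,4)]
  obtain C where C: "C > 0"
    and tail: "\<And>x. x > 0 \<Longrightarrow> prob {\<omega> \<in> space M. D x \<omega> \<le> t} \<le> exp (- C * x powr (1 / (1 - \<beta>)))"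
    using prob_le_tail[OF assms(2,4)] by blast
  show ?thesis
  proof (rule L.light_tail_not_infinitely_divisible)
    \<comment> \<open>The path starts at 0, below the level, so it cannot have left before time 0.\<close>
    have "AE \<omega> in M. 0 \<le> ?E \<omega>"
      using exits AE_space
    proof eventually_elim
      case (elim \<omega>)
      show ?case by (rule first_exit_time_ge) (use elim X_0[of \<omega>] \<open>t > 0\<close> in auto)
    qed
    then show "AE x in distr M borel ?E. 0 \<le> x"
      by (subst AE_distr_iff) auto
  next
    fix k
    show "\<not> (AE x in distr M borel ?E. x = k)"
    proof
      assume "AE x in distr M borel ?E. x = k"
      then have "AE \<omega> in M. ?E \<omega> = k" by (subst (asm) AE_distr_iff) auto
      then have "AE \<omega> in M. \<not> D (\<bar>k\<bar> + 1) \<omega> \<le> t"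
        using exits AE_space
      proof eventually_elim
        case (elim \<omega>)
        then show ?case using first_exit_time_ge[of \<omega> t "\<bar>k\<bar> + 1"] by auto
      qed
      then have "emeasure M {\<omega> \<in> space M. D (\<bar>k\<bar> + 1) \<omega> \<le> t} = 0"
        by (subst (asm) AE_iff_measurable[OF _ refl]) auto
      then show False
        using prob_le_pos[of t "\<bar>k\<bar> + 1"] assms by (simp add: emeasure_eq_measure)
    qed
  next
    show "C * (1 / 2) powr (1 / (1 - \<beta>)) > 0" using C by simp
    show "1 / (1 - \<beta>) > 1" using assms by (simp add: field_simps)
    fix x :: real assume x: "x > 0"
    \<comment> \<open>At \<open>E = x\<close> only times strictly before \<open>x\<close> are controlled, hence \<open>x / 2\<close>.\<close>
    have "measure (distr M borel ?E) {x..} = prob {\<omega> \<in> space M. ?E \<omega> \<ge> x}"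
      by (subst measure_distr) (auto simp: vimage_def Int_def conj_commute)
    also have "\<dots> \<le> prob {\<omega> \<in> space M. D (x / 2) \<omega> \<le> t}"
      using x by (intro finite_measure_mono) (auto intro!: le_before_first_exit_time)
    also have "\<dots> \<le> exp (- C * (x / 2) powr (1 / (1 - \<beta>)))" by (rule tail) (use x in simp)
    also have "- C * (x / 2) powr (1 / (1 - \<beta>))
        = - (C * (1 / 2) powr (1 / (1 - \<beta>))) * x powr (1 / (1 - \<beta>))"
      using x powr_mult[of x "1/2" "1 / (1 - \<beta>)"] by simp
    finally show "measure (distr M borel ?E) {x..}
        \<le> exp (- (C * (1 / 2) powr (1 / (1 - \<beta>))) * x powr (1 / (1 - \<beta>)))" .
  qed
qed

end
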